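(* Fix $T>0$ and let $u(\cdot,t)\in C^3(I)$ be a classical solution, for $t\in[0,T]$, to the initial boundary value problem $$u_t+f(u)_x=Q(\varepsilon u_x)_x\ \ (x\in I,\ t>0),\qquad u(\pm\ell,t)=u_\pm\ \ (t\ge0),\qquad u(x,0)=u_0(x)\ \ (x\in I),$$ where $Q\in C^2(\mathbb{R})$ satisfies $$Q(0)=0,\qquad \lim_{s\to\pm\infty}Q(s)=\pm Q_\infty,\qquad Q'(s)>0\ \ \forall s\in\mathbb{R},\qquad \lim_{|s|\to\infty}Q'(s)=0.$$ If $$\left\|Q(\varepsilon u_0')\right\|_{L^\infty}+2\|f(u_0)\|_{L^\infty}\le\beta<Q_\infty,$$ then $$\varepsilon\|u_x(\cdot,t)\|_{L^\infty}\le Q^{-1}(\beta)$$ for any $t\in[0,T]$.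
   Context: $\ell>0$, $I=(-\ell,\ell)$, $\varepsilon>0$, $f\in C^2(\mathbb{R})$, $u_\pm\in\mathbb{R}$, and $L^\infty=L^\infty(I)$. $Q^{-1}:(-Q_\infty,Q_\infty)\to\mathbb{R}$ is the inverse of $Q$.
   Formalization: The norm bound fails for some non-odd Q; it is proved when Q(s) ≤ −Q(−s) for all s ≥ 0 (e.g. Q odd), and for every Q as stated the two-sided bound Q⁻¹(−β) ≤ εu_x ≤ Q⁻¹(β) is proved instead. *)

theory Defs
  imports "HOL-Probability.Essential_Supremum"
begin

text \<open>Meant for open \<open>S\<close>, so that \<open>deriv\<close> at a point of \<open>S\<close> is the two-sided derivative
  and depends only on the values of the function in \<open>S\<close>.\<close>

definition C_on :: "nat \<Rightarrow> real set \<Rightarrow> (real \<Rightarrow> real) \<Rightarrow> bool" where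
  "C_on k S g \<longleftrightarrow>
     (\<forall>i<k. (deriv ^^ i) g differentiable_on S) \<and> continuous_on S ((deriv ^^ k) g)"

definition Linfty_norm :: "real set \<Rightarrow> (real \<Rightarrow> real) \<Rightarrow> ereal" where
  "Linfty_norm S g = esssup (lebesgue_on S) (\<lambda>x. ereal \<bar>g x\<bar>)"

abbreviation dx :: "(real \<Rightarrow> real \<Rightarrow> real) \<Rightarrow> real \<Rightarrow> real \<Rightarrow> real" where
  "dx u x t \<equiv> deriv (\<lambda>y. u y t) x"

text \<open>The second argument of \<open>u\<close> is time. At \<open>t = T\<close> the time derivative is the left
  derivative.\<close>

abbreviation dt :: "real \<Rightarrow> (real \<Rightarrow> real \<Rightarrow> real) \<Rightarrow> real \<Rightarrow> real \<Rightarrow> real" where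
  "dt T u x t \<equiv> vector_derivative (\<lambda>s. u x s) (at t within {0..T})"

text \<open>Classical solutions of
  \<open>u\<^sub>t + f(u)\<^sub>x = Q(\<epsilon> u\<^sub>x)\<^sub>x\<close> in \<open>I = (-l, l)\<close>, \<open>u(-l,t) = um\<close>, \<open>u(l,t) = up\<close>,
  \<open>u(x,0) = u0(x)\<close>, on the time interval \<open>[0,T]\<close>: \<open>u\<close> is continuous up to the parabolic
  boundary, the derivatives occurring in the equation are jointly continuous for \<open>x \<in> I\<close>
  and \<open>0 < t \<le> T\<close>, and \<open>u(\<cdot>,t)\<close> is of class \<open>C\<^sup>3\<close> in \<open>I\<close> for every \<open>t \<in> [0,T]\<close>.
  No regularity of derivatives at \<open>x = l\<close>, \<open>x = -l\<close>, no joint continuity of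
  derivatives at \<open>t = 0\<close> and no joint continuity of the third derivative is required.\<close>

definition classical_solution ::
  "real \<Rightarrow> real \<Rightarrow> real \<Rightarrow> (real \<Rightarrow> real) \<Rightarrow> (real \<Rightarrow> real) \<Rightarrow> real \<Rightarrow> real \<Rightarrow> (real \<Rightarrow> real)
    \<Rightarrow> (real \<Rightarrow> real \<Rightarrow> real) \<Rightarrow> bool" where
  "classical_solution l T \<epsilon> f Q um up u0 u \<longleftrightarrow>
     (\<forall>t\<in>{0..T}. C_on 3 {-l<..<l} (\<lambda>x. u x t)) \<and>
     continuous_on ({-l..l} \<times> {0..T}) (\<lambda>(x, t). u x t) \<and>
     (\<forall>x\<in>{-l<..<l}. \<forall>t\<in>{0<..T}. (\<lambda>s. u x s) differentiable (at t within {0..T})) \<and>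
     continuous_on ({-l<..<l} \<times> {0<..T}) (\<lambda>(x, t). dt T u x t) \<and>
     continuous_on ({-l<..<l} \<times> {0<..T}) (\<lambda>(x, t). dx u x t) \<and>
     continuous_on ({-l<..<l} \<times> {0<..T}) (\<lambda>(x, t). dx (dx u) x t) \<and>
     (\<forall>x\<in>{-l<..<l}. \<forall>t\<in>{0<..T}.
        dt T u x t + deriv (\<lambda>y. f (u y t)) x = deriv (\<lambda>y. Q (\<epsilon> * dx u y t)) x) \<and>
     (\<forall>t\<in>{0..T}. u (-l) t = um \<and> u l t = up) \<and>
     (\<forall>x\<in>{-l<..<l}. u x 0 = u0 x)"

text \<open>\<open>Q\<close> is not assumed to be odd. A bound \<open>\<bar>Q s\<bar> \<le> \<beta>\<close> then means
  \<open>inv Q (- \<beta>) \<le> s \<le> inv Q \<beta>\<close>, and \<open>\<bar>s\<bar> \<le> inv Q \<beta>\<close> follows only if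
  \<open>- inv Q (- \<beta>) \<le> inv Q \<beta>\<close>. The following condition, satisfied by odd functions, says
  that this holds for all admissible \<open>\<beta> \<ge> 0\<close>. Where it fails, with \<open>Q s > - Q (-s)\<close>, the
  stationary solution \<open>u(x,t) = - s x / \<epsilon>\<close> for \<open>f = 0\<close> and \<open>\<beta> = - Q (-s)\<close> has
  \<open>\<epsilon> \<bar>u\<^sub>x\<bar> = s > inv Q \<beta>\<close>.\<close>

definition reflection_dominated :: "(real \<Rightarrow> real) \<Rightarrow> bool" where
  "reflection_dominated Q \<longleftrightarrow> (\<forall>s\<ge>0. Q s \<le> - Q (- s))"

end

theory Submission
  imports Defs
begin

text \<open>The equation is the conservation law \<open>u\<^sub>t = w\<^sub>x\<close> for the flux
  \<open>w = Q(\<epsilon> u\<^sub>x) - f(u)\<close>. Formally \<open>w\<close> solves a linear parabolic equation with Neumann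
  boundary condition, so that its maximum is attained initially; together with the maximum principle
  for \<open>u\<close>, which keeps \<open>\<bar>f(u)\<bar>\<close> below its initial maximum \<open>F\<close>, this bounds
  \<open>\<bar>Q(\<epsilon> u\<^sub>x)\<bar>\<close> by \<open>A + 2 F\<close>, where \<open>A\<close> is the initial maximum of
  \<open>\<bar>Q(\<epsilon> u\<^sub>x)\<bar>\<close>. But differentiating \<open>w\<close> in time uses \<open>u\<^sub>x\<^sub>t\<close>, and the boundary condition uses derivatives of \<open>u\<close> up to the
  boundary; the solution concept provides neither.

  The inequality \<open>w \<le> K\<close> is therefore expressed through \<open>u\<close> itself. For \<open>K > A + F\<close> close to
  \<open>A + F\<close> it is equivalent to \<open>u\<^sub>x \<le> g(u)\<close>, where
  \<open>g(s) = Q\<^sup>-\<^sup>1(f(s) + K) / \<epsilon>\<close> is positive on the range of \<open>u\<close>. With \<open>G' = 1/g\<close> this says that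
  \<open>G(u(y,t)) - G(u(x,t)) \<le> y - x\<close> for \<open>x \<le> y\<close>, an inequality between values of \<open>u\<close> which is
  propagated by a maximum principle in the variables \<open>x\<close>, \<open>y\<close>, \<open>t\<close>
  (\<open>gradient_le_stationary_slope\<close>). At a violating maximum the slopes of \<open>G(u(\<cdot>,t))\<close> at
  \<open>x\<close> and \<open>y\<close> are one, hence \<open>w = K\<close> there, and maximality forces the sign of
  \<open>w\<^sub>x = u\<^sub>t\<close> (\<open>sign_related_deriv_at_max\<close>). If \<open>x\<close> or \<open>y\<close> is an end of the interval,
  \<open>u\<close> is constant in time there.

  Letting \<open>K\<close> tend to \<open>A + F\<close> gives the upper bound for \<open>Q(\<epsilon> u\<^sub>x)\<close> (\<open>flux_le\<close>). The lower bound
  is the upper bound for \<open>- u\<close>, which solves the equation with \<open>- f(- s)\<close> and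
  \<open>- Q(- s)\<close>.\<close>

section \<open>One-variable calculus\<close>

text \<open>A second-derivative test without second derivatives: if \<open>s - c\<close> and \<open>h'\<close> have the same
  sign and \<open>s\<close> increased through \<open>c\<close> at the maximum point, then \<open>h\<close> would increase to the right
  of it. Below, \<open>s\<close> is a flux, so that its derivative is, up to a vanishing term, \<open>u\<^sub>t\<close>.\<close>

lemma sign_related_deriv_at_max:
  fixes h k s :: "real \<Rightarrow> real"
  assumes S: "open S" "x0 \<in> S"
    and h: "\<And>x. x \<in> S \<Longrightarrow> (h has_real_derivative k x) (at x)"
    and mx: "\<And>x. x \<in> S \<Longrightarrow> h x \<le> h x0"
    and pos: "\<And>x. x \<in> S \<Longrightarrow> s x > c \<Longrightarrow> k x > 0"
    and neg: "\<And>x. x \<in> S \<Longrightarrow> s x < c \<Longrightarrow> k x < 0"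
    and s: "(s has_real_derivative D) (at x0)"
  shows "k x0 = 0" "D \<le> 0"
proof -
  from S obtain d where d: "d > 0" "\<And>x. \<bar>x0 - x\<bar> < d \<Longrightarrow> x \<in> S"
    by (metis open_dist dist_real_def dist_commute)
  show k0: "k x0 = 0"
    using DERIV_local_max[OF h[OF S(2)] d(1)] d(2) mx by blast
  then have s0: "s x0 = c"
    using pos[OF S(2)] neg[OF S(2)] by (metis less_irrefl linorder_cases)
  show "D \<le> 0"
  proof (rule ccontr)
    assume "\<not> D \<le> 0"
    then obtain e where e: "e > 0" "\<And>r. 0 < r \<Longrightarrow> r < e \<Longrightarrow> s x0 < s (x0 + r)"
      using DERIV_pos_inc_right[OF s] by auto
    define r where "r = min d e / 2"
    have r: "0 < r" "r < d" "r < e"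
      using d e by (auto simp: r_def min_def)
    have "h x0 < h (x0 + r)"
    proof (rule DERIV_pos_imp_increasing_open[where f = h])
      fix x assume x: "x0 < x" "x < x0 + r"
      then have xS: "x \<in> S" using d(2)[of x] r by auto
      have "s x > c" using e(2)[of "x - x0"] x r s0 by auto
      then show "\<exists>y. (h has_real_derivative y) (at x) \<and> y > 0"
        using h[OF xS] pos[OF xS] by blast
    next
      show "continuous_on {x0..x0 + r} h"
        using h d(2) r by (intro DERIV_continuous_on[where D = k])
          (auto intro!: DERIV_subset[where s = UNIV and t = "{x0..x0 + r}"])
    qed (use r in auto)
    moreover have "h (x0 + r) \<le> h x0"
      using mx d(2)[of "x0 + r"] r by auto
    ultimately show False by simp
  qed
qed

text \<open>The reflection \<open>x \<mapsto> - x\<close>, \<open>h \<mapsto> - h\<close> turns a minimum into a maximum and keeps the sign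
  relation between \<open>s\<close> and \<open>h'\<close>, but changes the sign of the derivative of \<open>s\<close>.\<close>

lemma sign_related_deriv_at_min:
  fixes h k s :: "real \<Rightarrow> real"
  assumes S: "open S" "x0 \<in> S"
    and h: "\<And>x. x \<in> S \<Longrightarrow> (h has_real_derivative k x) (at x)"
    and mn: "\<And>x. x \<in> S \<Longrightarrow> h x0 \<le> h x"
    and pos: "\<And>x. x \<in> S \<Longrightarrow> s x > c \<Longrightarrow> k x > 0"
    and neg: "\<And>x. x \<in> S \<Longrightarrow> s x < c \<Longrightarrow> k x < 0"
    and s: "(s has_real_derivative D) (at x0)"
  shows "D \<ge> 0"
proof -
  have "- D \<le> 0"
  proof (rule sign_related_deriv_at_max(2)[of "uminus ` S" "- x0" "\<lambda>x. - h (- x)" "\<lambda>x. k (- x)"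
        c "\<lambda>x. s (- x)"])
    show "open (uminus ` S)" using S(1) by (rule open_negations)
    show "((\<lambda>x. - h (- x)) has_real_derivative k (- x)) (at x)" if "x \<in> uminus ` S" for x
    proof -
      have "(h has_real_derivative k (- x)) (at (- x))" using that h by force
      from DERIV_minus[OF DERIV_chain2[OF this DERIV_minus[OF DERIV_ident]]] show ?thesis by simp
    qed
    have "(s has_real_derivative D) (at (- (- x0)))" using s by simp
    from DERIV_chain2[OF this DERIV_minus[OF DERIV_ident]]
    show "((\<lambda>x. s (- x)) has_real_derivative - D) (at (- x0))" by simp
  qed (use assms in auto)
  then show ?thesis by simp
qed

lemma DERIV_chain_within:
  assumes "(G has_field_derivative a) (at (w x) within B)"
    and "(w has_field_derivative b) (at x within S)" and "w ` S \<subseteq> B"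
  shows "((\<lambda>x. G (w x)) has_field_derivative a * b) (at x within S)"
  using DERIV_image_chain[OF DERIV_subset[OF assms(1,3)] assms(2)] by (simp add: o_def)

section \<open>The maximum principle\<close>

text \<open>If \<open>Z\<close> exceeded \<open>M\<close>, then so would \<open>Z z t - \<delta> t\<close> for some \<open>\<delta> > 0\<close>, and at a maximum
  of it over the space-time cylinder, which by the initial bound has \<open>t > 0\<close>, the left time
  derivative of \<open>Z z\<close> would be at least \<open>\<delta>\<close>.\<close>

lemma compact_maximum_principle:
  fixes Z :: "'a::topological_space \<Rightarrow> real \<Rightarrow> real"
  assumes C: "compact C" and cont: "continuous_on (C \<times> {0..T}) (\<lambda>(z, t). Z z t)"
    and init: "\<And>z. z \<in> C \<Longrightarrow> Z z 0 \<le> M"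
    and step: "\<And>z t. z \<in> C \<Longrightarrow> 0 < t \<Longrightarrow> t \<le> T \<Longrightarrow> (\<And>z'. z' \<in> C \<Longrightarrow> Z z' t \<le> Z z t) \<Longrightarrow> Z z t > M
      \<Longrightarrow> \<exists>D\<le>0. (Z z has_real_derivative D) (at t within {0..T})"
    and z: "z \<in> C" and t: "t \<in> {0..T}"
  shows "Z z t \<le> M"
proof (rule ccontr)
  assume "\<not> Z z t \<le> M"
  then have gt: "Z z t > M" and tpos: "t > 0"
    using init[OF z] t by (auto simp: less_le)
  \<comment> \<open>small enough for the penalised function still to exceed \<open>M\<close> somewhere\<close>
  define \<delta> where "\<delta> = (Z z t - M) / (2 * t)"
  have \<delta>: "\<delta> > 0" "Z z t - \<delta> * t > M"
    using gt tpos by (auto simp: \<delta>_def field_simps)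
  have "continuous_on (C \<times> {0..T}) (\<lambda>(z, t). Z z t - \<delta> * t)"
    using cont by (auto simp: case_prod_beta intro!: continuous_intros)
  moreover have "compact (C \<times> {0..T})" "C \<times> {0..T} \<noteq> {}"
    using C z t by (auto intro: compact_Times)
  ultimately obtain w where "w \<in> C \<times> {0..T}"
    "\<forall>y\<in>C \<times> {0..T}. (\<lambda>(z, t). Z z t - \<delta> * t) y \<le> (\<lambda>(z, t). Z z t - \<delta> * t) w"
    using continuous_attains_sup by blast
  then obtain z0 t0 where z0: "z0 \<in> C" and t0: "t0 \<in> {0..T}"
    and mx: "\<And>z t. z \<in> C \<Longrightarrow> t \<in> {0..T} \<Longrightarrow> Z z t - \<delta> * t \<le> Z z0 t0 - \<delta> * t0"
    by (cases w) auto
  have big: "Z z0 t0 - \<delta> * t0 > M"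
    using mx[OF z t] \<delta> by linarith
  have t0pos: "t0 > 0"
    using big init[OF z0] t0 by (cases "t0 = 0") auto
  have "Z z' t0 \<le> Z z0 t0" if "z' \<in> C" for z'
    using mx[OF that t0] by simp
  moreover have "Z z0 t0 > M"
    using big \<delta> t0pos mult_pos_pos[of \<delta> t0] by linarith
  ultimately obtain D where D: "D \<le> 0" "(Z z0 has_real_derivative D) (at t0 within {0..T})"
    using step[OF z0 t0pos] t0 by auto
  have "((\<lambda>t. Z z0 t - \<delta> * t) has_real_derivative D - \<delta>) (at t0 within {0..T})"
    using D(2) by (auto intro!: derivative_eq_intros)
  from has_real_derivative_neg_dec_left[OF this] D(1) \<delta>(1)
  obtain d where d: "d > 0" "\<And>h. h > 0 \<Longrightarrow> t0 - h \<in> {0..T} \<Longrightarrow> h < d \<Longrightarrow>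
      Z z0 t0 - \<delta> * t0 < Z z0 (t0 - h) - \<delta> * (t0 - h)"
    by auto
  define h where "h = min d t0 / 2"
  have h: "h > 0" "h < d" "t0 - h \<in> {0..T}"
    using d(1) t0pos t0 by (auto simp: h_def min_def)
  show False
    using d(2)[OF h(1,3,2)] mx[OF z0 h(3)] by simp
qed

section \<open>Gradient bounds by doubling variables\<close>

text \<open>The equation with the derivatives named, \<open>v = u\<^sub>x\<close> and \<open>q = u\<^sub>t\<close>, and \<open>f(u)\<^sub>x\<close> expanded.
  All conditions are invariant under \<open>u \<mapsto> - u\<close>, \<open>f \<mapsto> - f(- \<cdot>)\<close>, \<open>Q \<mapsto> - Q(- \<cdot>)\<close>, so that each
  upper bound proved from them yields a lower bound.\<close>

locale saturating_diffusion =
  fixes l T \<epsilon> um up :: real and f Q :: "real \<Rightarrow> real" and u v q :: "real \<Rightarrow> real \<Rightarrow> real"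
  assumes pos: "l > 0" "T > 0" "\<epsilon> > 0"
    and f_diff: "\<And>s. f differentiable (at s)"
    and Q_mono: "strict_mono Q" and Q_cont: "\<And>s. isCont Q s" and Q_0: "Q 0 = 0"
    and u_cont: "continuous_on ({-l..l} \<times> {0..T}) (\<lambda>(x, t). u x t)"
    and u_bdry: "\<And>t. t \<in> {0..T} \<Longrightarrow> u (-l) t = um" "\<And>t. t \<in> {0..T} \<Longrightarrow> u l t = up"
    and u_x: "\<And>x t. x \<in> {-l<..<l} \<Longrightarrow> t \<in> {0..T} \<Longrightarrow>
      ((\<lambda>y. u y t) has_real_derivative v x t) (at x)"
    and u_t: "\<And>x t. x \<in> {-l<..<l} \<Longrightarrow> t \<in> {0<..T} \<Longrightarrow>
      (u x has_real_derivative q x t) (at t within {0..T})"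
    and eqn: "\<And>x t. x \<in> {-l<..<l} \<Longrightarrow> t \<in> {0<..T} \<Longrightarrow>
      ((\<lambda>y. Q (\<epsilon> * v y t)) has_real_derivative q x t + deriv f (u x t) * v x t) (at x)"
begin

lemma f_deriv: "(f has_real_derivative deriv f s) (at s)"
  using f_diff DERIV_deriv_iff_real_differentiable by blast

lemma f_cont: "isCont f s"
  using f_deriv DERIV_isCont by blast

lemma u_cont_x: "t \<in> {0..T} \<Longrightarrow> continuous_on {-l..l} (\<lambda>x. u x t)"
  by (rule continuous_on_compose2[OF u_cont, of "{-l..l}" "\<lambda>x. (x, t)", simplified])
    (auto intro!: continuous_intros)

lemma flux_deriv:
  assumes "x \<in> {-l<..<l}" "t \<in> {0<..T}"
  shows "((\<lambda>y. Q (\<epsilon> * v y t) - f (u y t)) has_real_derivative q x t) (at x)"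
  using DERIV_diff[OF eqn[OF assms] DERIV_chain2[OF f_deriv u_x[of x t]]] assms by simp

text \<open>On the lateral boundary \<open>u\<close> does not change in time. Extending \<open>q\<close> there by zero lets the
  arguments below treat boundary maxima like interior ones.\<close>

definition q' :: "real \<Rightarrow> real \<Rightarrow> real" where
  "q' x t = (if x \<in> {-l<..<l} then q x t else 0)"

lemma u_t_closed:
  assumes "x \<in> {-l..l}" "t \<in> {0<..T}"
  shows "(u x has_real_derivative q' x t) (at t within {0..T})"
proof (cases "x \<in> {-l<..<l}")
  case True
  then show ?thesis using u_t assms by (auto simp: q'_def)
next
  case False
  then have "x = - l \<or> x = l" using assms by auto
  then have "\<And>s. s \<in> {0..T} \<Longrightarrow> u x t = u x s"
    using u_bdry assms(2) by auto
  then have "(u x has_real_derivative 0) (at t within {0..T})"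
    using assms(2)
    by (intro has_field_derivative_transform_within[OF DERIV_const[of "u x t"] zero_less_one]) auto
  then show ?thesis using False by (auto simp: q'_def)
qed

text \<open>Where \<open>u(\<cdot>,t)\<close> is maximal, \<open>u\<^sub>x = 0\<close> and \<open>Q(\<epsilon> u\<^sub>x)\<close> has the sign of \<open>u\<^sub>x\<close>; hence its
  derivative, which there equals \<open>u\<^sub>t\<close> because \<open>f(u)\<^sub>x = f'(u) u\<^sub>x\<close> vanishes, is not positive.\<close>

lemma u_le_initial_max:
  assumes init: "\<And>x. x \<in> {-l..l} \<Longrightarrow> u x 0 \<le> M"
    and x: "x \<in> {-l..l}" and t: "t \<in> {0..T}"
  shows "u x t \<le> M"
proof (rule compact_maximum_principle[OF _ u_cont init _ x t])
  fix x t assume x: "x \<in> {-l..l}" and t: "0 < t" "t \<le> T"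
    and mx: "\<And>z'. z' \<in> {-l..l} \<Longrightarrow> u z' t \<le> u x t"
  have "q' x t \<le> 0"
  proof (cases "x \<in> {-l<..<l}")
    case True
    have sgn: "Q (\<epsilon> * v y t) > 0 \<Longrightarrow> v y t > 0" "Q (\<epsilon> * v y t) < 0 \<Longrightarrow> v y t < 0" for y
      using strict_mono_less[OF Q_mono, of 0 "\<epsilon> * v y t"]
        strict_mono_less[OF Q_mono, of "\<epsilon> * v y t" 0] Q_0 pos
      by (auto simp: zero_less_mult_iff mult_less_0_iff)
    note * = sign_related_deriv_at_max[of "{-l<..<l}" x "\<lambda>y. u y t" "\<lambda>y. v y t"
        0 "\<lambda>y. Q (\<epsilon> * v y t)", OF _ True u_x _ sgn eqn[OF True]]
    have "v x t = 0" "q x t + deriv f (u x t) * v x t \<le> 0"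
      using * mx t by auto
    then show ?thesis using True by (auto simp: q'_def)
  qed (auto simp: q'_def)
  then show "\<exists>D\<le>0. (u x has_real_derivative D) (at t within {0..T})"
    using u_t_closed[OF x, of t] t by auto
qed (use t in auto)

text \<open>The profiles with \<open>Q(\<epsilon> \<phi>') - f(\<phi>) = K\<close> are stationary solutions; they solve \<open>\<phi>' = g(\<phi>)\<close>.
  In the coordinate \<open>G\<close> with \<open>G' = 1/g\<close> they all have slope one, so that \<open>u\<^sub>x \<le> g(u)\<close> means that
  \<open>G(u(y,t)) - G(u(x,t)) \<le> y - x\<close> for \<open>x \<le> y\<close>. The maximum principle in the doubled variable
  \<open>(x,y)\<close> preserves this: at an interior maximum of the difference of the two sides the flux equals
  \<open>K\<close> both at \<open>x\<close> and at \<open>y\<close>, and the sign of the flux minus \<open>K\<close> is that of the slope minus one,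
  whence \<open>u\<^sub>t \<le> 0\<close> at \<open>y\<close> and \<open>u\<^sub>t \<ge> 0\<close> at \<open>x\<close>. On the diagonal the difference is zero, and at
  \<open>x = -l\<close> or \<open>y = l\<close> the time derivative in question is zero.\<close>

lemma gradient_le_stationary_slope:
  assumes g_cont: "continuous_on {m..M} g" and g_pos: "\<And>s. s \<in> {m..M} \<Longrightarrow> g s > 0"
    and range: "\<And>x t. x \<in> {-l..l} \<Longrightarrow> t \<in> {0..T} \<Longrightarrow> u x t \<in> {m..M}"
    and g: "\<And>s. s \<in> {m..M} \<Longrightarrow> Q (\<epsilon> * g s) = f s + K"
    and init: "\<And>x. x \<in> {-l<..<l} \<Longrightarrow> v x 0 \<le> g (u x 0)"
    and x: "x \<in> {-l<..<l}" and t: "t \<in> {0..T}"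
  shows "v x t \<le> g (u x t)"
proof -
  have "continuous_on {m..M} (\<lambda>s. 1 / g s)"
    using g_cont g_pos by (intro continuous_intros) (auto simp: less_imp_neq[symmetric])
  from antiderivative_continuous[OF this] obtain G where
    "\<And>s. s \<in> {m..M} \<Longrightarrow> (G has_vector_derivative 1 / g s) (at s within {m..M})"
    by blast
  then have G: "(G has_real_derivative 1 / g s) (at s within {m..M})" if "s \<in> {m..M}" for s
    using that by (simp add: has_real_derivative_iff_has_vector_derivative)
  define p where "p x t = G (u x t)" for x t
  have p_x: "((\<lambda>y. p y t) has_real_derivative v x t / g (u x t)) (at x)"
    if "x \<in> {-l<..<l}" "t \<in> {0..T}" for x t
  proof -
    have u_x': "((\<lambda>y. u y t) has_real_derivative v x t) (at x within {-l<..<l})"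
      using u_x[OF that] by (rule DERIV_subset) simp
    have r: "u x t \<in> {m..M}" "(\<lambda>y. u y t) ` {-l<..<l} \<subseteq> {m..M}"
      using range[of _ t] that by auto
    have "((\<lambda>y. p y t) has_real_derivative 1 / g (u x t) * v x t) (at x within {-l<..<l})"
      unfolding p_def by (rule DERIV_chain_within[OF G[OF r(1)] u_x' r(2)])
    then show ?thesis using that at_within_open[of x "{-l<..<l}"] by simp
  qed
  have p_t: "(p x has_real_derivative q' x t / g (u x t)) (at t within {0..T})"
    if "x \<in> {-l..l}" "t \<in> {0<..T}" for x t
  proof -
    have r: "u x t \<in> {m..M}" "u x ` {0..T} \<subseteq> {m..M}"
      using range[of x] that by auto
    have "(p x has_real_derivative 1 / g (u x t) * q' x t) (at t within {0..T})"
      unfolding p_def by (rule DERIV_chain_within[OF G[OF r(1)] u_t_closed[OF that] r(2)])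
    then show ?thesis by simp
  qed
  have "continuous_on {m..M} G"
    using G by (rule DERIV_continuous_on)
  then have "continuous_on ({-l..l} \<times> {0..T}) (\<lambda>w. G ((\<lambda>(x, t). u x t) w))"
    by (rule continuous_on_compose2[OF _ u_cont]) (use range in auto)
  then have p_cont: "continuous_on ({-l..l} \<times> {0..T}) (\<lambda>(x, t). p x t)"
    by (simp add: p_def case_prod_beta)
  have flux_sign: "Q (\<epsilon> * v y t) - f (u y t) > K \<Longrightarrow> v y t / g (u y t) - 1 > 0"
    "Q (\<epsilon> * v y t) - f (u y t) < K \<Longrightarrow> v y t / g (u y t) - 1 < 0"
    if "y \<in> {-l<..<l}" "t \<in> {0..T}" for y t
  proof -
    have r: "u y t \<in> {m..M}" using range that by auto
    have "Q (\<epsilon> * g (u y t)) < Q (\<epsilon> * v y t) \<Longrightarrow> v y t > g (u y t)"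
      "Q (\<epsilon> * v y t) < Q (\<epsilon> * g (u y t)) \<Longrightarrow> v y t < g (u y t)"
      using pos by (auto simp: strict_mono_less[OF Q_mono])
    then show "Q (\<epsilon> * v y t) - f (u y t) > K \<Longrightarrow> v y t / g (u y t) - 1 > 0"
      "Q (\<epsilon> * v y t) - f (u y t) < K \<Longrightarrow> v y t / g (u y t) - 1 < 0"
      using g[OF r] g_pos[OF r] by auto
  qed
  have slope: "((\<lambda>y. p y t - y) has_real_derivative v y t / g (u y t) - 1) (at y)"
    if "y \<in> {-l<..<l}" "t \<in> {0..T}" for y t
    using p_x[OF that] by (auto intro!: derivative_eq_intros)

  define C where "C = {z::real \<times> real. - l \<le> fst z \<and> fst z \<le> snd z \<and> snd z \<le> l}"
  define Z where "Z z t = p (snd z) t - p (fst z) t - (snd z - fst z)" for z t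
  have C_sub: "C \<subseteq> {-l..l} \<times> {-l..l}"
    by (auto simp: C_def)
  have "closed C"
    unfolding C_def by (intro closed_Collect_conj closed_Collect_le continuous_intros)
  then have C: "compact C"
    using C_sub closed_Int_compact[of C "{-l..l} \<times> {-l..l}"]
    by (simp add: compact_Times inf.absorb1)
  have Z_cont: "continuous_on (C \<times> {0..T}) (\<lambda>(z, t). Z z t)"
  proof -
    have "continuous_on (C \<times> {0..T}) (\<lambda>w. (\<lambda>(x, t). p x t) (fst (fst w), snd w))"
      "continuous_on (C \<times> {0..T}) (\<lambda>w. (\<lambda>(x, t). p x t) (snd (fst w), snd w))"
      by (intro continuous_on_compose2[OF p_cont] continuous_intros; use C_sub in fastforce)+
    then show ?thesis
      by (auto simp: Z_def case_prod_beta intro!: continuous_intros)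
  qed
  have Z_le: "Z z t \<le> 0" if "z \<in> C" "t \<in> {0..T}" for z t
  proof (rule compact_maximum_principle[OF C Z_cont _ _ that])
    fix z assume z: "z \<in> C"
    have "continuous_on {-l..l} (\<lambda>y. p y 0)"
      using pos
      by (intro continuous_on_compose2[OF p_cont, of "{-l..l}" "\<lambda>x. (x, 0)", simplified])
        (auto intro!: continuous_intros)
    then have "continuous_on {-l..l} (\<lambda>y. p y 0 - y)"
      by (intro continuous_intros)
    then have "continuous_on {fst z..snd z} (\<lambda>y. p y 0 - y)"
      using z by (elim continuous_on_subset) (auto simp: C_def)
    moreover have "\<exists>D. ((\<lambda>y. p y 0 - y) has_real_derivative D) (at y) \<and> D \<le> 0"
      if "fst z < y" "y < snd z" for y
    proof -
      have y: "y \<in> {-l<..<l}" using that z by (auto simp: C_def)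
      then have "v y 0 / g (u y 0) - 1 \<le> 0"
        using init[OF y] g_pos[OF range[of y 0]] pos by auto
      then show ?thesis using slope[OF y, of 0] pos by auto
    qed
    ultimately have "p (snd z) 0 - snd z \<le> p (fst z) 0 - fst z"
      using z by (intro DERIV_nonpos_imp_decreasing_open[where f = "\<lambda>y. p y 0 - y"]) (auto simp: C_def)
    then show "Z z 0 \<le> 0" by (simp add: Z_def)
  next
    fix z t assume z: "z \<in> C" and t: "0 < t" "t \<le> T"
      and mx: "\<And>z'. z' \<in> C \<Longrightarrow> Z z' t \<le> Z z t" and zpos: "Z z t > 0"
    obtain x y where xy: "z = (x, y)" by (cases z)
    have le: "- l \<le> x" "x \<le> y" "y \<le> l" using z by (auto simp: C_def xy)
    have "x \<noteq> y" using zpos by (auto simp: Z_def xy)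
    then have less: "x < y" using le by simp
    have "q' y t \<le> 0"
    proof (cases "y = l")
      case False
      then have y: "y \<in> {x<..<l}" "y \<in> {-l<..<l}" using le less by auto
      have sub: "y' \<in> {-l<..<l}" if "y' \<in> {x<..<l}" for y' using that le by auto
      have "q y t \<le> 0"
      proof (rule sign_related_deriv_at_max(2)[of "{x<..<l}" y "\<lambda>y. p y t - y"
            "\<lambda>y. v y t / g (u y t) - 1" K "\<lambda>y. Q (\<epsilon> * v y t) - f (u y t)"])
        show "p y' t - y' \<le> p y t - y" if "y' \<in> {x<..<l}" for y'
          using mx[of "(x, y')"] that le by (auto simp: C_def Z_def xy)
      qed (use y sub slope flux_sign flux_deriv t in auto)
      then show ?thesis using y by (auto simp: q'_def)
    qed (auto simp: q'_def)
    moreover have "q' x t \<ge> 0"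
    proof (cases "x = - l")
      case False
      then have x: "x \<in> {-l<..<y}" "x \<in> {-l<..<l}" using le less by auto
      have sub: "x' \<in> {-l<..<l}" if "x' \<in> {-l<..<y}" for x' using that le by auto
      have "q x t \<ge> 0"
      proof (rule sign_related_deriv_at_min[of "{-l<..<y}" x "\<lambda>y. p y t - y"
            "\<lambda>y. v y t / g (u y t) - 1" K "\<lambda>y. Q (\<epsilon> * v y t) - f (u y t)"])
        show "p x t - x \<le> p x' t - x'" if "x' \<in> {-l<..<y}" for x'
          using mx[of "(x', y)"] that le by (auto simp: C_def Z_def xy)
      qed (use x sub slope flux_sign flux_deriv t in auto)
      then show ?thesis using x by (auto simp: q'_def)
    qed (auto simp: q'_def)
    moreover have "g (u x t) > 0" "g (u y t) > 0"
      using g_pos range le t by auto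
    ultimately have "q' y t / g (u y t) - q' x t / g (u x t) \<le> 0"
      by (smt (verit) divide_nonneg_pos divide_nonpos_pos)
    moreover have "(Z z has_real_derivative q' y t / g (u y t) - q' x t / g (u x t)) (at t within {0..T})"
      unfolding Z_def xy using p_t[of x t] p_t[of y t] le t
      by (auto intro!: derivative_eq_intros)
    ultimately show "\<exists>D\<le>0. (Z z has_real_derivative D) (at t within {0..T})" by blast
  qed
  \<comment> \<open>The difference quotients of \<open>p\<close> are at most one, hence so is its slope.\<close>
  have "v x t / g (u x t) - 1 \<le> 0"
  proof (rule ccontr)
    assume "\<not> v x t / g (u x t) - 1 \<le> 0"
    then obtain d where d: "d > 0" "\<And>h. 0 < h \<Longrightarrow> h < d \<Longrightarrow> p x t - x < p (x + h) t - (x + h)"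
      using DERIV_pos_inc_right[OF slope[OF x t]] by auto
    define h where "h = min d (l - x) / 2"
    have "h > 0" "h < d" "x + h < l" using d(1) x by (auto simp: h_def min_def field_simps)
    then show False
      using d(2)[of h] Z_le[of "(x, x + h)" t] x t by (auto simp: C_def Z_def)
  qed
  then show ?thesis
    using g_pos[OF range[of x t]] x t by (auto simp: field_simps)
qed

lemma reflected:
  "saturating_diffusion l T \<epsilon> (- um) (- up) (\<lambda>s. - f (- s)) (\<lambda>s. - Q (- s))
    (\<lambda>x t. - u x t) (\<lambda>x t. - v x t) (\<lambda>x t. - q x t)"
proof
  have neg: "((\<lambda>s. - f (- s)) has_real_derivative deriv f (- s)) (at s)" for s
    using DERIV_minus[OF DERIV_chain2[OF f_deriv DERIV_minus[OF DERIV_ident]]] by simp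
  then show "(\<lambda>s. - f (- s)) differentiable (at s)" for s
    using real_differentiable_def by blast
  show "strict_mono (\<lambda>s. - Q (- s))"
    using Q_mono by (simp add: strict_mono_def)
  show "isCont (\<lambda>s. - Q (- s)) s" for s
    using isCont_o2[of s uminus Q] Q_cont by (auto intro!: continuous_intros)
  show "continuous_on ({-l..l} \<times> {0..T}) (\<lambda>(x, t). - u x t)"
    using u_cont by (auto simp: case_prod_beta intro!: continuous_intros)
  show "((\<lambda>y. - Q (- (\<epsilon> * - v y t))) has_real_derivative
      - q x t + deriv (\<lambda>s. - f (- s)) (- u x t) * - v x t) (at x)"
    if "x \<in> {-l<..<l}" "t \<in> {0<..T}" for x t
    using DERIV_minus[OF eqn[OF that]] DERIV_imp_deriv[OF neg, of "- u x t"] by simp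
qed (use pos Q_0 u_bdry in \<open>auto intro!: DERIV_minus u_x u_t\<close>)

text \<open>Any \<open>K = A + F + \<eta>\<close> with \<open>\<eta> > 0\<close> makes \<open>f + K\<close> positive on the range of \<open>u\<close>, as
  \<open>A \<ge> 0\<close>, and bounds the initial flux; for small \<open>\<eta>\<close>, \<open>f + K\<close> stays inside the range of
  \<open>Q\<close>. Then the stationary slope exists, and \<open>Q(\<epsilon> u\<^sub>x) \<le> f(u) + K \<le> F + K\<close>.\<close>

lemma flux_le:
  assumes A: "\<And>x. x \<in> {-l<..<l} \<Longrightarrow> Q (\<epsilon> * v x 0) \<le> A" "A \<ge> 0"
    and F: "\<And>x. x \<in> {-l<..<l} \<Longrightarrow> \<bar>f (u x 0)\<bar> \<le> F"
    and range_Q: "{0..<Qinf} \<subseteq> range Q" and less: "A + 2 * F < Qinf"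
    and x: "x \<in> {-l<..<l}" and t: "t \<in> {0..T}"
  shows "Q (\<epsilon> * v x t) \<le> A + 2 * F"
proof -
  interpret neg: saturating_diffusion l T \<epsilon> "- um" "- up" "\<lambda>s. - f (- s)" "\<lambda>s. - Q (- s)"
    "\<lambda>x t. - u x t" "\<lambda>x t. - v x t" "\<lambda>x t. - q x t"
    by (rule reflected)
  have cont0: "continuous_on {-l..l} (\<lambda>x. u x 0)"
    using u_cont_x pos by simp
  then have "connected ((\<lambda>x. u x 0) ` {-l..l}) \<and> compact ((\<lambda>x. u x 0) ` {-l..l})"
    by (auto intro: connected_continuous_image compact_continuous_image)
  \<comment> \<open>The initial values fill an interval, so every value that \<open>u\<close> can take later is an initial value
    and obeys the initial bound on \<open>f\<close>.\<close>
  then obtain m M where mM: "(\<lambda>x. u x 0) ` {-l..l} = {m..M}"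
    unfolding connected_compact_interval_1 by blast
  have init: "u x 0 \<le> M" "- u x 0 \<le> - m" if "x \<in> {-l..l}" for x
    using imageI[OF that, of "\<lambda>x. u x 0"] mM by auto
  have range: "u x t \<in> {m..M}" if "x \<in> {-l..l}" "t \<in> {0..T}" for x t
    using u_le_initial_max[OF init(1) that] neg.u_le_initial_max[OF init(2) that] by auto
  have f_le: "\<bar>f s\<bar> \<le> F" if s: "s \<in> {m..M}" for s
  proof -
    obtain x where x: "x \<in> {-l..l}" "s = u x 0"
      using s unfolding mM[symmetric] by blast
    have "continuous_on {-l..l} (\<lambda>x. \<bar>f (u x 0)\<bar>)"
      using f_cont by (intro continuous_intros continuous_on_compose2[OF _ cont0, of UNIV f])
        (auto simp: continuous_at_imp_continuous_on)
    then show ?thesis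
      using continuous_le_on_closure[of "{-l<..<l}" "\<lambda>x. \<bar>f (u x 0)\<bar>" x F] F x pos by simp
  qed
  have "Q (\<epsilon> * v x t) \<le> A + 2 * F + \<eta>" if \<eta>: "\<eta> > 0" "A + 2 * F + \<eta> < Qinf" for \<eta>
  proof -
    define K where "K = A + F + \<eta>"
    define g where "g s = inv Q (f s + K) / \<epsilon>" for s
    have inj: "inv Q (Q s) = s" for s
      using Q_mono by (simp add: strict_mono_imp_inj_on)
    have fK: "0 < f s + K" "f s + K < Qinf" if "s \<in> {m..M}" for s
      using f_le[OF that] A(2) \<eta> by (auto simp: K_def)
    have g: "Q (\<epsilon> * g s) = f s + K" if "s \<in> {m..M}" for s
    proof -
      have "f s + K \<in> range Q" using fK[OF that] range_Q by auto
      then show ?thesis using pos by (simp add: g_def f_inv_into_f)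
    qed
    have g_pos: "g s > 0" if "s \<in> {m..M}" for s
    proof -
      have "Q 0 < Q (\<epsilon> * g s)" using fK[OF that] g[OF that] Q_0 by simp
      then show ?thesis using pos by (simp add: strict_mono_less[OF Q_mono] zero_less_mult_iff)
    qed
    have inv_cont: "isCont (inv Q) (Q s)" for s
      using isCont_inverse_function[of 1 s "inv Q" Q] inj Q_cont by simp
    have "isCont g s" if "s \<in> {m..M}" for s
    proof -
      have "isCont (inv Q) (f s + K)" using inv_cont[of "\<epsilon> * g s"] g[OF that] by simp
      then have "isCont (\<lambda>s. inv Q (f s + K)) s"
        using f_cont by (intro isCont_o2[of s "\<lambda>s. f s + K" "inv Q"]) (auto intro!: continuous_intros)
      then show ?thesis unfolding g_def using pos by (intro continuous_intros) auto
    qed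
    then have g_cont: "continuous_on {m..M} g"
      by (simp add: continuous_at_imp_continuous_on)
    have "v x t \<le> g (u x t)"
    proof (rule gradient_le_stationary_slope[OF g_cont g_pos range g _ x t])
      fix x assume x: "x \<in> {-l<..<l}"
      have r: "u x 0 \<in> {m..M}" using range[of x 0] x pos by auto
      have "Q (\<epsilon> * v x 0) \<le> Q (\<epsilon> * g (u x 0))"
        using g[OF r] A(1)[OF x] F[OF x] \<eta> by (auto simp: K_def)
      then show "v x 0 \<le> g (u x 0)"
        using pos by (simp add: strict_mono_less_eq[OF Q_mono])
    qed
    then have "Q (\<epsilon> * v x t) \<le> Q (\<epsilon> * g (u x t))"
      using pos by (simp add: strict_mono_less_eq[OF Q_mono])
    also have "\<dots> \<le> A + 2 * F + \<eta>"
      using g[of "u x t"] f_le[of "u x t"] range[of x t] x t by (auto simp: K_def)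
    finally show ?thesis .
  qed
  then have *: "Q (\<epsilon> * v x t) \<le> A + 2 * F + \<eta>" if "0 < \<eta>" "\<eta> < Qinf - (A + 2 * F)" for \<eta>
    using that by auto
  show ?thesis
  proof (rule ccontr)
    assume n: "\<not> ?thesis"
    define \<eta> where "\<eta> = min (Qinf - (A + 2 * F)) (Q (\<epsilon> * v x t) - (A + 2 * F)) / 2"
    have "0 < \<eta>" "\<eta> < Qinf - (A + 2 * F)" "\<eta> < Q (\<epsilon> * v x t) - (A + 2 * F)"
      using n less by (auto simp: \<eta>_def min_def)
    then show False using *[of \<eta>] by linarith
  qed
qed

lemma abs_flux_le:
  assumes A: "\<And>x. x \<in> {-l<..<l} \<Longrightarrow> \<bar>Q (\<epsilon> * v x 0)\<bar> \<le> A"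
    and F: "\<And>x. x \<in> {-l<..<l} \<Longrightarrow> \<bar>f (u x 0)\<bar> \<le> F"
    and range_Q: "{- Qinf<..<Qinf} \<subseteq> range Q" and less: "A + 2 * F < Qinf"
    and x: "x \<in> {-l<..<l}" and t: "t \<in> {0..T}"
  shows "\<bar>Q (\<epsilon> * v x t)\<bar> \<le> A + 2 * F"
proof -
  interpret neg: saturating_diffusion l T \<epsilon> "- um" "- up" "\<lambda>s. - f (- s)" "\<lambda>s. - Q (- s)"
    "\<lambda>x t. - u x t" "\<lambda>x t. - v x t" "\<lambda>x t. - q x t"
    by (rule reflected)
  have nonneg: "A \<ge> 0" "F \<ge> 0" using A[OF x] F[OF x] by auto
  have "r \<in> range (\<lambda>s. - Q (- s))" if "r \<in> {0..<Qinf}" for r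
  proof -
    have "- r \<in> range Q" using that range_Q by auto
    then obtain s where "- r = Q s" by auto
    then show ?thesis by (intro image_eqI[of _ _ "- s"]) auto
  qed
  then have range_neg: "{0..<Qinf} \<subseteq> range (\<lambda>s. - Q (- s))" by blast
  have "Q (\<epsilon> * v x 0) \<le> A" "- Q (- (\<epsilon> * - v x 0)) \<le> A" if "x \<in> {-l<..<l}" for x
    using A[OF that] by auto
  moreover have "\<bar>- f (- (- u x 0))\<bar> \<le> F" if "x \<in> {-l<..<l}" for x
    using F[OF that] by simp
  moreover have "{0..<Qinf} \<subseteq> range Q" using range_Q nonneg less by force
  ultimately show ?thesis
    using flux_le[of A F Qinf x t] neg.flux_le[of A F Qinf x t] F nonneg range_neg less x t by auto
qed

end

section \<open>Essential suprema of continuous functions\<close>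

text \<open>For a continuous function, a set on which it exceeds its essential supremum is open, and a
  nonempty open set is not null.\<close>

lemma continuous_on_le_Linfty_norm:
  assumes S: "open S" and h: "continuous_on S h" and x: "x \<in> S"
  shows "ereal \<bar>h x\<bar> \<le> Linfty_norm S h"
proof (rule ccontr)
  assume "\<not> ?thesis"
  then have "Linfty_norm S h < ereal \<bar>h x\<bar>" by simp
  then obtain b where b: "Linfty_norm S h < ereal b" "b < \<bar>h x\<bar>"
    using ereal_dense2[of "Linfty_norm S h" "ereal \<bar>h x\<bar>"] by auto
  have ae: "AE y in lebesgue_on S. ereal \<bar>h y\<bar> \<le> Linfty_norm S h"
    unfolding Linfty_norm_def by (rule esssup_AE)
  then have ae: "AE y in lebesgue_on S. \<bar>h y\<bar> \<le> b"
  proof (rule eventually_mono)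
    fix y assume "ereal \<bar>h y\<bar> \<le> Linfty_norm S h"
    then have "ereal \<bar>h y\<bar> < ereal b" using b(1) by (rule le_less_trans)
    then show "\<bar>h y\<bar> \<le> b" by simp
  qed
  define U where "U = {y \<in> S. b < \<bar>h y\<bar>}"
  have "S \<in> sets lebesgue" using S by simp
  then have "AE y in lebesgue. y \<in> S \<longrightarrow> \<bar>h y\<bar> \<le> b"
    using ae by (simp add: AE_restrict_space_iff)
  then have "AE y in lebesgue. y \<notin> U"
    by eventually_elim (auto simp: U_def)
  moreover have "openin (top_of_set S) (S \<inter> (\<lambda>y. \<bar>h y\<bar>) -` {b<..})"
    using h by (intro continuous_openin_preimage_gen continuous_intros) auto
  then have "open U"
    using S by (auto simp: U_def vimage_def Int_def openin_open_eq)
  moreover have "U \<in> sets lebesgue" using \<open>open U\<close> by simp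
  ultimately have "U \<in> null_sets lebesgue"
    by (simp add: AE_iff_null_sets)
  then have "negligible U" by (simp add: negligible_iff_null_sets)
  then show False
    using open_not_negligible[OF \<open>open U\<close>] x b(2) by (auto simp: U_def)
qed

lemma Linfty_norm_le:
  assumes S: "open S" and h: "continuous_on S h" and le: "\<And>x. x \<in> S \<Longrightarrow> \<bar>h x\<bar> \<le> c"
  shows "Linfty_norm S h \<le> ereal c"
  unfolding Linfty_norm_def
proof (rule esssup_I)
  have "S \<in> sets lebesgue" using S by simp
  then have "h \<in> borel_measurable (lebesgue_on S)"
    using h by (rule continuous_imp_measurable_on_sets_lebesgue[rotated])
  then show "(\<lambda>x. ereal \<bar>h x\<bar>) \<in> borel_measurable (lebesgue_on S)" by simp
  show "AE x in lebesgue_on S. ereal \<bar>h x\<bar> \<le> ereal c"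
    using le by (intro AE_I2) (simp add: space_restrict_space)
qed

section \<open>The gradient bound for classical solutions\<close>

lemma C_on_DERIV:
  assumes "C_on k S g" "i < k" "open S" "x \<in> S"
  shows "((deriv ^^ i) g has_real_derivative (deriv ^^ Suc i) g x) (at x)"
proof -
  have "(deriv ^^ i) g differentiable (at x within S)"
    using assms unfolding C_on_def differentiable_on_def by blast
  then show ?thesis
    using at_within_open[OF assms(4,3)] by (simp add: DERIV_deriv_iff_real_differentiable)
qed

text \<open>The equation is stated with \<open>deriv\<close>; the differentiability that makes it
  meaningful comes from the regularity of \<open>u(\<cdot>,t)\<close>, \<open>f\<close> and \<open>Q\<close>.\<close>

lemma classical_solution_imp_saturating_diffusion:
  assumes pos: "l > 0" "T > 0" "\<epsilon> > 0"
    and f: "C_on 2 UNIV f" and Q: "C_on 2 UNIV Q"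
    and Q0: "Q 0 = 0" and Q': "\<forall>s. deriv Q s > 0"
    and sol: "classical_solution l T \<epsilon> f Q um up u0 u"
  shows "saturating_diffusion l T \<epsilon> um up f Q u (dx u) (dt T u)"
proof
  note sol = sol[unfolded classical_solution_def]
  have Q_deriv: "(Q has_real_derivative deriv Q s) (at s)" for s
    using C_on_DERIV[OF Q, of 0 s] by simp
  have f_deriv: "(f has_real_derivative deriv f s) (at s)" for s
    using C_on_DERIV[OF f, of 0 s] by simp
  show "f differentiable (at s)" for s
    using f_deriv real_differentiable_def by blast
  show "strict_mono Q"
    unfolding strict_mono_def using Q_deriv Q' DERIV_pos_imp_increasing by metis
  show "isCont Q s" for s using Q_deriv DERIV_isCont by blast
  show ux: "((\<lambda>y. u y t) has_real_derivative dx u x t) (at x)"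
    if "x \<in> {-l<..<l}" "t \<in> {0..T}" for x t
    using C_on_DERIV[of 3 "{-l<..<l}" "\<lambda>y. u y t" 0 x] sol that by simp
  show "(u x has_real_derivative dt T u x t) (at t within {0..T})"
    if "x \<in> {-l<..<l}" "t \<in> {0<..T}" for x t
    using sol that by (simp add: vector_derivative_works has_real_derivative_iff_has_vector_derivative)
  show "((\<lambda>y. Q (\<epsilon> * dx u y t)) has_real_derivative dt T u x t + deriv f (u x t) * dx u x t) (at x)"
    if x: "x \<in> {-l<..<l}" and t: "t \<in> {0<..T}" for x t
  proof -
    have t': "t \<in> {0..T}" using t by auto
    have "((\<lambda>y. dx u y t) has_real_derivative (deriv ^^ 2) (\<lambda>y. u y t) x) (at x)"
      using C_on_DERIV[of 3 "{-l<..<l}" "\<lambda>y. u y t" 1 x] sol x t' by (simp add: numeral_2_eq_2)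
    from DERIV_chain2[OF Q_deriv DERIV_cmult[OF this]]
    have "((\<lambda>y. Q (\<epsilon> * dx u y t)) has_real_derivative deriv (\<lambda>y. Q (\<epsilon> * dx u y t)) x) (at x)"
      by (metis DERIV_imp_deriv)
    moreover have "deriv (\<lambda>y. f (u y t)) x = deriv f (u x t) * dx u x t"
      using DERIV_chain2[OF f_deriv ux[OF x t']] by (rule DERIV_imp_deriv)
    moreover have "dt T u x t + deriv (\<lambda>y. f (u y t)) x = deriv (\<lambda>y. Q (\<epsilon> * dx u y t)) x"
      using sol x t by blast
    ultimately show ?thesis by simp
  qed
qed (use sol[unfolded classical_solution_def] pos Q0 in auto)

lemma range_between_limits:
  fixes Q :: "real \<Rightarrow> real"
  assumes cont: "\<And>s. isCont Q s"
    and top: "(Q \<longlongrightarrow> b) at_top" and bot: "(Q \<longlongrightarrow> a) at_bot"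
  shows "{a<..<b} \<subseteq> range Q"
proof
  fix y assume y: "y \<in> {a<..<b}"
  have "eventually (\<lambda>s. y < Q s) at_top" "eventually (\<lambda>s. Q s < y) at_bot"
    using order_tendstoD(1)[OF top] order_tendstoD(2)[OF bot] y by auto
  then obtain s1 s2 where s: "\<And>s. s \<ge> s1 \<Longrightarrow> y < Q s" "\<And>s. s \<le> s2 \<Longrightarrow> Q s < y"
    by (auto simp: eventually_at_top_linorder eventually_at_bot_linorder)
  have "\<exists>x. min s1 s2 \<le> x \<and> x \<le> max s1 s2 \<and> Q x = y"
    using s(1)[of "max s1 s2"] s(2)[of "min s1 s2"] cont by (intro IVT) auto
  then show "y \<in> range Q" by auto
qed

theorem proposition3p1:
  fixes l T \<epsilon> \<beta> Qinf um up :: real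
    and f Q u0 :: "real \<Rightarrow> real"
    and u :: "real \<Rightarrow> real \<Rightarrow> real"
  assumes "l > 0" and "T > 0" and "\<epsilon> > 0"
    and "C_on 2 UNIV f"
    and "C_on 2 UNIV Q"
    and "Q 0 = 0"
    and "(Q \<longlongrightarrow> Qinf) at_top" and "(Q \<longlongrightarrow> - Qinf) at_bot"
    and "\<forall>s. deriv Q s > 0"
    and "(deriv Q \<longlongrightarrow> 0) at_infinity"
    and "classical_solution l T \<epsilon> f Q um up u0 u"
    and "Linfty_norm {-l<..<l} (\<lambda>x. Q (\<epsilon> * deriv u0 x))
           + 2 * Linfty_norm {-l<..<l} (\<lambda>x. f (u0 x)) \<le> ereal \<beta>"
    and "\<beta> < Qinf"
  shows "\<forall>t\<in>{0..T}.
           (\<forall>x\<in>{-l<..<l}. inv Q (- \<beta>) \<le> \<epsilon> * dx u x t \<and> \<epsilon> * dx u x t \<le> inv Q \<beta>) \<and>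
           (reflection_dominated Q \<longrightarrow>
              ereal \<epsilon> * Linfty_norm {-l<..<l} (\<lambda>x. dx u x t) \<le> ereal (inv Q \<beta>))"
proof -
  interpret saturating_diffusion l T \<epsilon> um up f Q u "dx u" "dt T u"
    using assms by (intro classical_solution_imp_saturating_diffusion) auto
  note sol = assms(11)[unfolded classical_solution_def]
  let ?I = "{-l<..<l}"
  have v_cont: "continuous_on ?I (\<lambda>x. dx u x t)" if "t \<in> {0..T}" for t
  proof -
    have "((\<lambda>y. dx u y t) has_real_derivative deriv (\<lambda>y. dx u y t) x) (at x)" if "x \<in> ?I" for x
      using C_on_DERIV[of 3 ?I "\<lambda>y. u y t" 1 x] sol \<open>t \<in> {0..T}\<close> that by simp
    then show ?thesis
      by (metis DERIV_isCont continuous_at_imp_continuous_on)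
  qed
  \<comment> \<open>\<open>u0\<close> and \<open>u(\<cdot>,0)\<close> agree on the open interval, hence so do their derivatives.\<close>
  have u0: "u0 x = u x 0" "deriv u0 x = dx u x 0" if "x \<in> ?I" for x
  proof -
    show "u0 x = u x 0" using sol that by simp
    have "eventually (\<lambda>y. y \<in> ?I) (nhds x)"
      using that by (intro eventually_nhds_in_open) auto
    then have "eventually (\<lambda>y. u0 y = u y 0) (nhds x)"
      by (rule eventually_mono) (use sol in auto)
    then show "deriv u0 x = dx u x 0" by (intro deriv_cong_ev) auto
  qed
  define A B where "A = Linfty_norm ?I (\<lambda>x. Q (\<epsilon> * deriv u0 x))"
    and "B = Linfty_norm ?I (\<lambda>x. f (u0 x))"
  have "continuous_on UNIV Q" "continuous_on UNIV f"
    using Q_cont f_cont by (auto simp: continuous_at_imp_continuous_on)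
  note comp = this[THEN continuous_on_compose2, OF _ subset_UNIV]
  have "continuous_on ?I (\<lambda>x. \<epsilon> * dx u x 0)"
    using v_cont[of 0] assms(2) by (intro continuous_intros) auto
  then have "continuous_on ?I (\<lambda>x. Q (\<epsilon> * dx u x 0))"
    by (rule comp(1))
  then have cA: "continuous_on ?I (\<lambda>x. Q (\<epsilon> * deriv u0 x))"
    by (rule continuous_on_eq) (simp add: u0)
  have "continuous_on ?I (\<lambda>x. u x 0)"
    using assms(2) by (intro continuous_on_subset[OF u_cont_x]) auto
  then have "continuous_on ?I (\<lambda>x. f (u x 0))"
    by (rule comp(2))
  then have cB: "continuous_on ?I (\<lambda>x. f (u0 x))"
    by (rule continuous_on_eq) (simp add: u0)
  have A: "ereal \<bar>Q (\<epsilon> * dx u x 0)\<bar> \<le> A" if "x \<in> ?I" for x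
    using continuous_on_le_Linfty_norm[OF _ cA that] u0[OF that] by (simp add: A_def)
  have B: "ereal \<bar>f (u x 0)\<bar> \<le> B" if "x \<in> ?I" for x
    using continuous_on_le_Linfty_norm[OF _ cB that] u0[OF that] by (simp add: B_def)
  have "0 \<in> ?I" using assms(1) by simp
  have AB: "A + 2 * B \<le> ereal \<beta>" using assms(12) by (simp add: A_def B_def)
  have nn: "0 \<le> A" "0 \<le> B"
    using order_trans[OF _ A[OF \<open>0 \<in> ?I\<close>], of 0] order_trans[OF _ B[OF \<open>0 \<in> ?I\<close>], of 0] by auto
  obtain a b where ab: "A = ereal a" "B = ereal b" "a + 2 * b \<le> \<beta>"
    using AB nn by (cases A; cases B) auto
  have rng: "{- Qinf<..<Qinf} \<subseteq> range Q"
    using range_between_limits[OF Q_cont assms(7,8)] .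
  have \<beta>: "0 \<le> \<beta>" using ab nn by auto
  have inv: "Q (inv Q \<beta>) = \<beta>" "Q (inv Q (- \<beta>)) = - \<beta>"
    using rng \<beta> assms(13) by (auto intro!: f_inv_into_f)
  have bound: "\<bar>Q (\<epsilon> * dx u x t)\<bar> \<le> \<beta>" if "x \<in> ?I" "t \<in> {0..T}" for x t
  proof -
    have "\<bar>Q (\<epsilon> * dx u x t)\<bar> \<le> a + 2 * b"
      using A B ab assms(13) by (intro abs_flux_le[OF _ _ rng _ that]) auto
    then show ?thesis using ab by simp
  qed
  have two_sided: "inv Q (- \<beta>) \<le> \<epsilon> * dx u x t" "\<epsilon> * dx u x t \<le> inv Q \<beta>"
    if "x \<in> ?I" "t \<in> {0..T}" for x t
  proof -
    have "Q (inv Q (- \<beta>)) \<le> Q (\<epsilon> * dx u x t)" "Q (\<epsilon> * dx u x t) \<le> Q (inv Q \<beta>)"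
      using bound[OF that] inv by auto
    then show "inv Q (- \<beta>) \<le> \<epsilon> * dx u x t" "\<epsilon> * dx u x t \<le> inv Q \<beta>"
      by (auto simp: strict_mono_less_eq[OF Q_mono])
  qed
  have norm: "ereal \<epsilon> * Linfty_norm ?I (\<lambda>x. dx u x t) \<le> ereal (inv Q \<beta>)"
    if refl: "reflection_dominated Q" and t: "t \<in> {0..T}" for t
  proof -
    \<comment> \<open>Applied at \<open>s = - inv Q (- \<beta>) \<ge> 0\<close>, the hypothesis on \<open>Q\<close> says \<open>Q s \<le> \<beta>\<close>.\<close>
    have "Q (inv Q (- \<beta>)) \<le> Q 0" using inv Q_0 \<beta> by simp
    then have "inv Q (- \<beta>) \<le> 0" by (simp add: strict_mono_less_eq[OF Q_mono])
    then have "Q (- inv Q (- \<beta>)) \<le> Q (inv Q \<beta>)"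
      using refl[unfolded reflection_dominated_def, rule_format, of "- inv Q (- \<beta>)"] inv by simp
    then have lower: "- inv Q (- \<beta>) \<le> inv Q \<beta>"
      by (simp add: strict_mono_less_eq[OF Q_mono])
    have "\<bar>dx u x t\<bar> \<le> inv Q \<beta> / \<epsilon>" if "x \<in> ?I" for x
    proof -
      have "\<bar>\<epsilon> * dx u x t\<bar> \<le> inv Q \<beta>" using two_sided[OF that t] lower by auto
      then show ?thesis using assms(3) by (simp add: abs_mult field_simps)
    qed
    then have "Linfty_norm ?I (\<lambda>x. dx u x t) \<le> ereal (inv Q \<beta> / \<epsilon>)"
      using v_cont[OF t] by (intro Linfty_norm_le) auto
    then have "ereal \<epsilon> * Linfty_norm ?I (\<lambda>x. dx u x t) \<le> ereal \<epsilon> * ereal (inv Q \<beta> / \<epsilon>)"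
      using assms(3) by (intro ereal_mult_left_mono) auto
    then show ?thesis using assms(3) by simp
  qed
  show ?thesis using two_sided norm by blast
qed

end
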